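(* Let $N\ge 1$ be an integer. For real $K$ with $1\le K\le N$ let $E(T)=\frac{N+1}{K+1}$ and $E(D)=\frac{K+1}{2}$ be the expected ranks of the chosen dessert for Tanya and Dan (as described in the context, extended to real $K$). Then the expected total rank $E(T)+E(D)$, as a function of $K\in[1,N]$, is minimized when $K=\sqrt{2N+2}-1$. Moreover, this choice of $K$ results in equal expected ranks for each participant, namely $$E(T)=E(D)=\sqrt{\frac{N+1}{2}}.$$
   Context: Dan and Tanya share one dessert from a menu of $N$ desserts. Each of them ranks all desserts from $1$ (favorite) to $N$ (least favorite); the two rankings are independent uniformly random permutations. For an integer $K$ with $1\le K\le N$, the algorithm is: Dan reveals his top $K$ desserts (those he ranks $1,\dots,K$), and Tanya then chooses, among these $K$ desserts, the one with the smallest Tanya-rank. Let $T$ be the rank of the chosen dessert according to Tanya and $D$ its rank according to Dan. For integer $K$ the expected values are $E(T)=\frac{N+1}{K+1}$ and $E(D)=\frac{K+1}{2}$. Since the optimizing $K$ is usually not an integer, $E(T)$ and $E(D)$ are understood for real $K$ through these same formulas. *)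

theory Defs
  imports "HOL-Probability.Probability" "HOL-Combinatorics.Permutations"
begin

text \<open>
  The desserts are \<open>{1..N}\<close>; a ranking is a permutation of \<open>{1..N}\<close>, sending each dessert
  to its rank.
\<close>

definition rankings :: "nat \<Rightarrow> (nat \<Rightarrow> nat) set" where
  "rankings N = {r. r permutes {1..N}}"

definition ranking_pair_pmf :: "nat \<Rightarrow> ((nat \<Rightarrow> nat) \<times> (nat \<Rightarrow> nat)) pmf" where
  "ranking_pair_pmf N = pair_pmf (pmf_of_set (rankings N)) (pmf_of_set (rankings N))"

definition revealed :: "nat \<Rightarrow> nat \<Rightarrow> (nat \<Rightarrow> nat) \<Rightarrow> nat set" where
  "revealed N K dan = {x \<in> {1..N}. dan x \<le> K}"

definition chosen :: "nat \<Rightarrow> nat \<Rightarrow> (nat \<Rightarrow> nat) \<Rightarrow> (nat \<Rightarrow> nat) \<Rightarrow> nat" where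
  "chosen N K dan tanya = arg_min_on tanya (revealed N K dan)"

definition rank_Tanya :: "nat \<Rightarrow> nat \<Rightarrow> (nat \<Rightarrow> nat) \<times> (nat \<Rightarrow> nat) \<Rightarrow> nat" where
  "rank_Tanya N K = (\<lambda>(dan, tanya). tanya (chosen N K dan tanya))"

definition rank_Dan :: "nat \<Rightarrow> nat \<Rightarrow> (nat \<Rightarrow> nat) \<times> (nat \<Rightarrow> nat) \<Rightarrow> nat" where
  "rank_Dan N K = (\<lambda>(dan, tanya). dan (chosen N K dan tanya))"

text \<open>
  The expected ranks for real \<open>K\<close>. For integers \<open>1 \<le> K \<le> N\<close> they are the expectations of
  \<open>rank_Tanya\<close> and \<open>rank_Dan\<close>, by the lemmas \<open>expectation_rank_Tanya\<close> and
  \<open>expectation_rank_Dan\<close> below.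
\<close>

definition E_T :: "nat \<Rightarrow> real \<Rightarrow> real" where
  "E_T N K = (real N + 1) / (K + 1)"

definition E_D :: "real \<Rightarrow> real" where
  "E_D K = (K + 1) / 2"

lemma finite_rankings: "finite (rankings N)"
  unfolding rankings_def by (rule finite_permutations) simp

lemma rankings_nonempty: "rankings N \<noteq> {}"
  unfolding rankings_def using permutes_id by blast

lemma card_rankings_pos: "card (rankings N) > 0"
  using finite_rankings rankings_nonempty by (simp add: card_gt_0_iff)

lemma rankings_inj: "r \<in> rankings N \<Longrightarrow> inj r"
  unfolding rankings_def by (auto intro: permutes_inj)

lemma arg_min_on_eq_iff:
  assumes "r \<in> rankings N" "finite B" "a \<in> B"
  shows "arg_min_on r B = a \<longleftrightarrow> (\<forall>b\<in>B. r a \<le> r b)"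
proof -
  have B: "B \<noteq> {}" using assms by auto
  have m: "arg_min_on r B \<in> B" "\<And>b. b \<in> B \<Longrightarrow> r (arg_min_on r B) \<le> r b"
    using arg_min_if_finite(1)[OF assms(2) B] arg_min_least[OF assms(2) B] by blast+
  show ?thesis
  proof
    assume "\<forall>b\<in>B. r a \<le> r b"
    with m assms(3) have "r (arg_min_on r B) = r a" by (meson le_antisym)
    with rankings_inj[OF assms(1)] show "arg_min_on r B = a" by (auto dest: injD)
  qed (use m in auto)
qed

lemma card_arg_min_eq:
  assumes B: "B \<subseteq> {1..N}" and a: "a \<in> B"
  shows "real (card {r \<in> rankings N. arg_min_on r B = a}) = real (card (rankings N)) / real (card B)"
proof -
  have fB: "finite B" using B finite_subset by blast
  define S where "S = (\<lambda>c. {r \<in> rankings N. arg_min_on r B = c})"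
  have le: "card (S c) \<le> card (S d)" if c: "c \<in> B" and d: "d \<in> B" for c d
  proof (rule card_inj_on_le)
    let ?t = "Transposition.transpose c d"
    have tp: "?t permutes {1..N}" using c d B by (intro permutes_swap_id) auto
    have tB: "?t b \<in> B" if "b \<in> B" for b using that c d by (auto simp: Transposition.transpose_def)
    show "inj_on (\<lambda>r. r \<circ> ?t) (S c)"
    proof (rule inj_onI)
      fix r s assume "r \<circ> ?t = s \<circ> ?t"
      then have "r \<circ> ?t \<circ> ?t = s \<circ> ?t \<circ> ?t" by simp
      then show "r = s" by (simp add: comp_assoc)
    qed
    show "(\<lambda>r. r \<circ> ?t) ` S c \<subseteq> S d"
    proof
      fix q assume "q \<in> (\<lambda>r. r \<circ> ?t) ` S c"
      then obtain r where r: "r \<in> rankings N" "arg_min_on r B = c" and q: "q = r \<circ> ?t"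
        by (auto simp: S_def)
      have q': "q \<in> rankings N" using r(1) tp unfolding q rankings_def
        by (auto intro: permutes_compose)
      have "\<forall>b\<in>B. r c \<le> r b" using arg_min_on_eq_iff[OF r(1) fB c] r(2) by simp
      then have "\<forall>b\<in>B. q d \<le> q b" unfolding q using tB by auto
      then show "q \<in> S d" using arg_min_on_eq_iff[OF q' fB d] q' by (simp add: S_def)
    qed
    show "finite (S d)" using finite_rankings by (simp add: S_def)
  qed
  have U: "rankings N = (\<Union>c\<in>B. S c)"
    using arg_min_if_finite(1)[OF fB] a by (auto simp: S_def)
  have "card (rankings N) = (\<Sum>c\<in>B. card (S c))"
    unfolding U by (rule card_UN_disjoint) (use fB finite_rankings in \<open>auto simp: S_def\<close>)
  also have "\<dots> = (\<Sum>c\<in>B. card (S a))" by (rule sum.cong) (use le a in \<open>auto intro: le_antisym\<close>)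
  finally have "card (rankings N) = card B * card (S a)" by simp
  moreover have "card B > 0" using fB a card_gt_0_iff by blast
  ultimately show ?thesis by (simp add: S_def)
qed

lemma sum_arg_min_on:
  fixes f :: "nat \<Rightarrow> real"
  assumes B: "B \<subseteq> {1..N}" "B \<noteq> {}"
  shows "(\<Sum>r\<in>rankings N. f (arg_min_on r B)) = card (rankings N) * (\<Sum>a\<in>B. f a) / card B"
proof -
  have fB: "finite B" using B finite_subset by blast
  have "(\<Sum>r\<in>rankings N. f (arg_min_on r B)) =
      (\<Sum>a\<in>B. \<Sum>r\<in>{r\<in>rankings N. arg_min_on r B = a}. f (arg_min_on r B))"
    by (rule sum.group[symmetric])
      (use fB finite_rankings arg_min_if_finite(1)[OF fB B(2)] in auto)
  also have "\<dots> = (\<Sum>a\<in>B. f a * (card (rankings N) / card B))"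
    by (rule sum.cong) (simp_all add: card_arg_min_eq[OF B(1), symmetric])
  also have "\<dots> = (\<Sum>a\<in>B. f a) * (card (rankings N) / card B)"
    by (rule sum_distrib_right[symmetric])
  finally show ?thesis by (simp add: mult.commute)
qed

lemma card_below_ranking:
  assumes "r \<in> rankings N" "a \<in> {1..N}"
  shows "r a = Suc (card {x \<in> {1..N}. r x < r a})"
proof -
  have p: "r permutes {1..N}" using assms by (simp add: rankings_def)
  have "r ` {x \<in> {1..N}. r x < r a} = {y \<in> r ` {1..N}. y < r a}" by auto
  also have "\<dots> = {1..<r a}"
    using permutes_image[OF p] permutes_in_image[OF p, of a] assms(2) by auto
  finally have "card (r ` {x \<in> {1..N}. r x < r a}) = r a - 1" by simp
  moreover have "card (r ` {x \<in> {1..N}. r x < r a}) = card {x \<in> {1..N}. r x < r a}"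
    by (rule card_image) (use rankings_inj[OF assms(1)] in \<open>auto intro: inj_on_subset\<close>)
  moreover have "r a \<ge> 1" using permutes_in_image[OF p, of a] assms(2) by auto
  ultimately show ?thesis by simp
qed

lemma sum_min_rank:
  assumes B: "B \<subseteq> {1..N}" "B \<noteq> {}"
  shows "(\<Sum>r\<in>rankings N. real (r (arg_min_on r B))) =
    card (rankings N) * (real N + 1) / (real (card B) + 1)"
proof -
  have fB: "finite B" using B finite_subset by blast
  let ?C = "{1..N} - B"
  have *: "real (r (arg_min_on r B)) =
      1 + (\<Sum>x\<in>?C. if arg_min_on r (insert x B) = x then 1 else 0)" if r: "r \<in> rankings N" for r
  proof -
    let ?a = "arg_min_on r B"
    have a: "?a \<in> B" "\<And>b. b \<in> B \<Longrightarrow> r ?a \<le> r b"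
      using arg_min_if_finite(1)[OF fB B(2)] arg_min_least[OF fB B(2)] by blast+
    have e: "arg_min_on r (insert x B) = x \<longleftrightarrow> r x < r ?a" if "x \<in> ?C" for x
    proof -
      have "r x \<noteq> r ?a" using that a(1) rankings_inj[OF r] by (auto dest: injD)
      moreover have "arg_min_on r (insert x B) = x \<longleftrightarrow> (\<forall>b\<in>insert x B. r x \<le> r b)"
        using arg_min_on_eq_iff[OF r, of "insert x B" x] fB by simp
      ultimately show ?thesis using a by fastforce
    qed
    have "{x \<in> {1..N}. r x < r ?a} = {x \<in> ?C. r x < r ?a}" using a(2) by (auto simp: not_less[symmetric])
    also have "\<dots> = {x \<in> ?C. arg_min_on r (insert x B) = x}" using e by blast
    finally have "real (r ?a) = 1 + real (card {x \<in> ?C. arg_min_on r (insert x B) = x})"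
      using card_below_ranking[OF r, of ?a] a(1) B(1) by (metis of_nat_Suc subsetD)
    also have "real (card {x \<in> ?C. arg_min_on r (insert x B) = x}) =
      (\<Sum>x\<in>?C. if arg_min_on r (insert x B) = x then 1 else 0)"
      using sum.inter_filter[of ?C "\<lambda>_. 1::real" "\<lambda>x. arg_min_on r (insert x B) = x"] by simp
    finally show ?thesis .
  qed
  let ?R = "real (card (rankings N))"
  have "(\<Sum>r\<in>rankings N. real (r (arg_min_on r B))) =
      (\<Sum>r\<in>rankings N. 1 + (\<Sum>x\<in>?C. if arg_min_on r (insert x B) = x then 1 else 0))"
    using * by (rule sum.cong[OF refl])
  also have "\<dots> = ?R + (\<Sum>x\<in>?C. \<Sum>r\<in>rankings N. if arg_min_on r (insert x B) = x then 1 else 0)"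
    unfolding sum.distrib by (subst sum.swap) simp
  also have "(\<Sum>x\<in>?C. \<Sum>r\<in>rankings N. if arg_min_on r (insert x B) = x then 1 else (0::real)) =
      (\<Sum>x\<in>?C. ?R / (real (card B) + 1))"
  proof (rule sum.cong[OF refl])
    fix x assume x: "x \<in> ?C"
    have "(\<Sum>r\<in>rankings N. if arg_min_on r (insert x B) = x then 1 else (0::real)) =
        card {r \<in> rankings N. arg_min_on r (insert x B) = x}"
      using sum.inter_filter[OF finite_rankings,
          where g = "\<lambda>_. 1::real" and P = "\<lambda>r. arg_min_on r (insert x B) = x"] by simp
    also have "\<dots> = ?R / card (insert x B)"
      by (rule card_arg_min_eq) (use x B in auto)
    also have "card (insert x B) = card B + 1" using x fB by simp
    finally show "(\<Sum>r\<in>rankings N. if arg_min_on r (insert x B) = x then 1 else (0::real)) =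
      ?R / (real (card B) + 1)" by simp
  qed
  also have "\<dots> = real (N - card B) * (?R / (real (card B) + 1))"
    using B(1) fB by (simp add: card_Diff_subset)
  finally show ?thesis
    using card_mono[OF _ B(1)] by (simp add: of_nat_diff field_simps)
qed

lemma revealed_card:
  assumes "dan \<in> rankings N" "K \<le> N"
  shows "dan ` revealed N K dan = {1..K}" "card (revealed N K dan) = K"
proof -
  have p: "dan permutes {1..N}" using assms by (simp add: rankings_def)
  have "dan ` revealed N K dan = {y \<in> dan ` {1..N}. y \<le> K}" by (auto simp: revealed_def)
  also have "\<dots> = {1..K}" unfolding permutes_image[OF p] using assms by auto
  finally show *: "dan ` revealed N K dan = {1..K}" .
  have "card (dan ` revealed N K dan) = card (revealed N K dan)"
    by (rule card_image) (use rankings_inj[OF assms(1)] in \<open>auto intro: inj_on_subset\<close>)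
  with * show "card (revealed N K dan) = K" by simp
qed

lemma expectation_ranking_pair:
  fixes f :: "_ \<Rightarrow> real"
  shows "measure_pmf.expectation (ranking_pair_pmf N) f =
    (\<Sum>dan\<in>rankings N. \<Sum>tanya\<in>rankings N. f (dan, tanya)) / (real (card (rankings N)))\<^sup>2"
proof -
  have "ranking_pair_pmf N = pmf_of_set (rankings N \<times> rankings N)"
    unfolding ranking_pair_pmf_def
    by (rule pmf_eqI) (auto simp: pmf_pair finite_rankings rankings_nonempty indicator_def card_cartesian_product)
  then show ?thesis
    by (simp add: integral_pmf_of_set finite_rankings rankings_nonempty
        sum.cartesian_product power2_eq_square)
qed

lemma expectation_rank_Tanya:
  assumes "1 \<le> K" "K \<le> N"
  shows "measure_pmf.expectation (ranking_pair_pmf N) (\<lambda>\<omega>. real (rank_Tanya N K \<omega>)) = E_T N (real K)"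
proof -
  have "(\<Sum>tanya\<in>rankings N. real (rank_Tanya N K (dan, tanya))) =
      card (rankings N) * (real N + 1) / (real K + 1)" if d: "dan \<in> rankings N" for dan
    using sum_min_rank[of "revealed N K dan" N] revealed_card[OF d assms(2)] assms(1)
    by (force simp: rank_Tanya_def chosen_def revealed_def)
  then show ?thesis
    using card_rankings_pos[of N]
    by (simp add: expectation_ranking_pair E_T_def power2_eq_square)
qed

lemma expectation_rank_Dan:
  assumes "1 \<le> K" "K \<le> N"
  shows "measure_pmf.expectation (ranking_pair_pmf N) (\<lambda>\<omega>. real (rank_Dan N K \<omega>)) = E_D (real K)"
proof -
  have "(\<Sum>tanya\<in>rankings N. real (rank_Dan N K (dan, tanya))) =
      card (rankings N) * ((real K + 1) / 2)" if d: "dan \<in> rankings N" for dan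
  proof -
    let ?A = "revealed N K dan"
    have A: "?A \<subseteq> {1..N}" "?A \<noteq> {}"
      using revealed_card[OF d assms(2)] assms(1) by (auto simp: revealed_def)
    have "(\<Sum>a\<in>?A. real (dan a)) = (\<Sum>i\<in>dan ` ?A. real i)"
      using rankings_inj[OF d] by (subst sum.reindex) (auto intro: inj_on_subset)
    also have "\<dots> = real K * (real K + 1) / 2"
      using double_gauss_sum_from_Suc_0[of K, where 'a = real] revealed_card(1)[OF d assms(2)]
      by simp
    finally have *: "(\<Sum>a\<in>?A. real (dan a)) = real K * (real K + 1) / 2" .
    show ?thesis
      unfolding rank_Dan_def chosen_def prod.case
        sum_arg_min_on[OF A, of "\<lambda>a. real (dan a)"] revealed_card(2)[OF d assms(2)] *
      using assms(1) by simp
  qed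
  then have "(\<Sum>dan\<in>rankings N. \<Sum>tanya\<in>rankings N. real (rank_Dan N K (dan, tanya))) =
      (\<Sum>dan\<in>rankings N. card (rankings N) * ((real K + 1) / 2))"
    by (rule sum.cong[OF refl])
  then show ?thesis
    using card_rankings_pos[of N]
    by (simp add: expectation_ranking_pair E_D_def power2_eq_square)
qed

end

theory Submission
  imports Defs
begin

text \<open>With s = sqrt (2N + 2), the two expected ranks are s^2 / (2(K + 1)) and (K + 1) / 2,
  whose product does not depend on K. Completing the square, as in \<open>E_T_plus_E_D_eq\<close>,
  writes their sum as the constant s plus a nonnegative remainder that vanishes exactly at K + 1 =
  s. There both ranks equal s/2.\<close>

lemma E_T_plus_E_D_eq:
  assumes "K > -1"
  shows "E_T N K + E_D K =
    sqrt (2 * real N + 2) + (K + 1 - sqrt (2 * real N + 2))\<^sup>2 / (2 * (K + 1))"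
proof -
  have "(sqrt (2 * real N + 2))\<^sup>2 = 2 * real N + 2" by simp
  with assms show ?thesis
    by (simp add: E_T_def E_D_def divide_simps power2_diff) (simp add: algebra_simps power2_eq_square)
qed

theorem theorem4:
  fixes N :: nat
  assumes "N \<ge> 1"
  shows "(\<forall>K::real. is_arg_min (\<lambda>K. E_T N K + E_D K) (\<lambda>K. K \<in> {1..real N}) K
             \<longleftrightarrow> K = sqrt (2 * real N + 2) - 1)
       \<and> E_T N (sqrt (2 * real N + 2) - 1) = E_D (sqrt (2 * real N + 2) - 1)
       \<and> E_D (sqrt (2 * real N + 2) - 1) = sqrt ((real N + 1) / 2)"
proof -
  define s where "s = sqrt (2 * real N + 2)"
  have s_sq: "s\<^sup>2 = 2 * real N + 2" by (simp add: s_def)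
  \<comment> \<open>The two bounds on s place the candidate s - 1 inside [1, N], so the constraint
    does not cut it off.\<close>
  have "2 \<le> s" unfolding s_def by (rule real_le_rsqrt) (use assms in simp)
  \<comment> \<open>After squaring, s \<le> N + 1 reads 2N + 2 \<le> (N + 1)^2, that is, 1 \<le>
    N^2.\<close>
  have "1 \<le> (real N)\<^sup>2" using assms by (intro one_le_power) simp
  then have "s \<le> real N + 1"
    unfolding s_def by (intro real_le_lsqrt) (simp_all add: power2_sum)
  with \<open>2 \<le> s\<close> have s_in: "s - 1 \<in> {1..real N}" by simp
  have total: "E_T N K + E_D K = s + (K + 1 - s)\<^sup>2 / (2 * (K + 1))"
    if "K \<in> {1..real N}" for K
    using E_T_plus_E_D_eq[of K N] that by (simp add: s_def)
  have "is_arg_min (\<lambda>K. E_T N K + E_D K) (\<lambda>K. K \<in> {1..real N}) K \<longleftrightarrow> K = s - 1" for K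
  proof
    assume min: "is_arg_min (\<lambda>K. E_T N K + E_D K) (\<lambda>K. K \<in> {1..real N}) K"
    then have K: "K \<in> {1..real N}" by (simp add: is_arg_min_def)
    have "E_T N K + E_D K \<le> E_T N (s - 1) + E_D (s - 1)"
      using min s_in unfolding is_arg_min_linorder by blast
    \<comment> \<open>The remainder is zero at s - 1, so a minimizer has remainder at most 0; as K +
      1 > 0, the square must vanish.\<close>
    then have "(K + 1 - s)\<^sup>2 / (2 * (K + 1)) \<le> 0"
      using total[OF K] total[OF s_in] by simp
    with K show "K = s - 1" by (simp add: divide_le_0_iff)
  next
    assume "K = s - 1"
    then show "is_arg_min (\<lambda>K. E_T N K + E_D K) (\<lambda>K. K \<in> {1..real N}) K"
      using s_in total unfolding is_arg_min_linorder by auto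
  qed
  moreover have "E_T N (s - 1) = E_D (s - 1)"
    using \<open>2 \<le> s\<close> s_sq by (simp add: E_T_def E_D_def field_simps power2_eq_square)
  \<comment> \<open>The value is s/2, which is nonnegative and has square s^2 / 4 = (N + 1) /
    2.\<close>
  moreover have "E_D (s - 1) = sqrt ((real N + 1) / 2)"
    using \<open>2 \<le> s\<close> s_sq
    by (intro real_sqrt_unique[symmetric]) (simp_all add: E_D_def power_divide)
  ultimately show ?thesis unfolding s_def by blast
qed

end
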